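(* Let $F,L\ge 1$ and $M\ge 0$ be integers and $\mathcal F=\{1,\dots,F\}$. Let $S=\{s_i^l \mid i\in\mathcal F,\ l\in\{1,\dots,L\}\}$ be a set of $FL$ distinct elements, $S_i=\{s_i^l\mid l\in\{1,\dots,L\}\}$, and $\mathcal I=\{C\subseteq S \mid |C|\le M\}$. Then the constraints $$c_i^o\in\{0,1,\dots,L\}\ \ \forall i\in\mathcal F,\qquad \sum_{i=1}^F c_i^o\le M$$ on a content placement $(c_1^o,\dots,c_F^o)$ can be expressed as the matroid $\mathcal M=(S,\mathcal I)$. That is, $(S,\mathcal I)$ is a matroid, and a vector $(c_1^o,\dots,c_F^o)$ satisfies these constraints if and only if there is $C\in\mathcal I$ with $c_i^o=|C\cap S_i|$ for all $i\in\mathcal F$.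
   Context: A user with memory for $M$ packets stores packets of $F$ contents, each content consisting of $L$ packets; $c_i^o$ is the number of packets of content $i$ stored, and $s_i^l$ stands for the $l$-th packet of content $i$. Since packets are coded with a maximum distance separable code, only the number of stored packets of each content matters, and a set $C\subseteq S$ represents the content placement $c_i^o=|C\cap S_i|$. A matroid $(S,\mathcal I)$ is a finite ground set $S$ with a family $\mathcal I$ of subsets such that: (1) $\mathcal I$ is nonempty; (2) if $Y\in\mathcal I$ and $X\subseteq Y$ then $X\in\mathcal I$; (3) if $X,Y\in\mathcal I$ and $|X|<|Y|$ then there is $y\in Y\setminus X$ with $X\cup\{y\}\in\mathcal I$. *)

theory Defs
  imports Complex_Main
begin

definition matroid :: "'a set \<Rightarrow> 'a set set \<Rightarrow> bool" where
  "matroid S \<I> \<longleftrightarrow>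
     finite S \<and> \<I> \<subseteq> Pow S \<and>
     \<I> \<noteq> {} \<and>
     (\<forall>X Y. Y \<in> \<I> \<and> X \<subseteq> Y \<longrightarrow> X \<in> \<I>) \<and>
     (\<forall>X Y. X \<in> \<I> \<and> Y \<in> \<I> \<and> card X < card Y \<longrightarrow>
        (\<exists>y\<in>Y - X. X \<union> {y} \<in> \<I>))"

(* s i l is the l-th packet of content i; only indices 1 \<le> i \<le> F and 1 \<le> l \<le> L matter. *)

definition content_packets :: "(nat \<Rightarrow> nat \<Rightarrow> 'a) \<Rightarrow> nat \<Rightarrow> nat \<Rightarrow> 'a set" where
  "content_packets s L i = {s i l | l. l \<in> {1..L}}"

definition all_packets :: "(nat \<Rightarrow> nat \<Rightarrow> 'a) \<Rightarrow> nat \<Rightarrow> nat \<Rightarrow> 'a set" where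
  "all_packets s F L = {s i l | i l. i \<in> {1..F} \<and> l \<in> {1..L}}"

definition storable_sets :: "(nat \<Rightarrow> nat \<Rightarrow> 'a) \<Rightarrow> nat \<Rightarrow> nat \<Rightarrow> nat \<Rightarrow> 'a set set" where
  "storable_sets s F L M = {C. C \<subseteq> all_packets s F L \<and> card C \<le> M}"

(* Placements are real-valued, so that c i \<in> {0, 1, ..., L} is a genuine integrality
   and range constraint instead of being partly enforced by the type.
   Components of c outside {1..F} are irrelevant. *)
definition placement_constraints :: "nat \<Rightarrow> nat \<Rightarrow> nat \<Rightarrow> (nat \<Rightarrow> real) \<Rightarrow> bool" where
  "placement_constraints F L M c \<longleftrightarrow>
     (\<forall>i\<in>{1..F}. c i \<in> real ` {0..L}) \<and> (\<Sum>i=1..F. c i) \<le> real M"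

end

theory Submission
  imports Defs
begin

text \<open>The sets of size at most \<open>M\<close> in a finite ground set form the uniform
  matroid: a subset is no larger, and a smaller set can take any element of a larger one that it
  lacks without exceeding \<open>M\<close> (\<open>matroid_uniform\<close>). For the equivalence,
  distinctness of the packets makes the blocks S_i a partition of S into blocks of size
  \<open>L\<close>. Hence |C| is the sum of the block counts |C \<inter> S_i|
  (\<open>card_eq_sum_contents\<close>), so the memory constraint on the counts is exactly |C| \<le>
  \<open>M\<close>. Conversely, the counts can be prescribed independently, each anywhere from 0 to
  \<open>L\<close> (\<open>ex_packets_with_counts\<close>), so every vector meeting the constraints
  comes from some set.\<close>

lemma matroid_uniform:
  assumes "finite S"
  shows "matroid S {C. C \<subseteq> S \<and> card C \<le> M}"
  unfolding matroid_def
proof (intro conjI allI impI)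
  show "finite S" by (fact assms)
  show "{C. C \<subseteq> S \<and> card C \<le> M} \<subseteq> Pow S" by blast
  have "{} \<in> {C. C \<subseteq> S \<and> card C \<le> M}" by simp
  then show "{C. C \<subseteq> S \<and> card C \<le> M} \<noteq> {}" by blast
next
  fix X Y
  assume *: "Y \<in> {C. C \<subseteq> S \<and> card C \<le> M} \<and> X \<subseteq> Y"
  then have "finite Y" using assms finite_subset by blast
  then have "card X \<le> card Y" using * card_mono by blast
  then show "X \<in> {C. C \<subseteq> S \<and> card C \<le> M}" using * by auto
next
  fix X Y
  assume *: "X \<in> {C. C \<subseteq> S \<and> card C \<le> M} \<and> Y \<in> {C. C \<subseteq> S \<and> card C \<le> M} \<and> card X < card Y"
  then have fin: "finite X" using assms finite_subset by blast
  then have "\<not> Y \<subseteq> X" using * card_mono[of X Y] by auto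
  then obtain y where y: "y \<in> Y - X" by blast
  then have "card (X \<union> {y}) = Suc (card X)" using fin by simp
  \<comment> \<open>The strict inequality leaves room for one more element: card X + 1 \<le> card Y
    \<le> M.\<close>
  then have "X \<union> {y} \<in> {C. C \<subseteq> S \<and> card C \<le> M}" using * y by auto
  with y show "\<exists>y\<in>Y - X. X \<union> {y} \<in> {C. C \<subseteq> S \<and> card C \<le> M}" by blast
qed

lemma content_packets_eq_image: "content_packets s L i = s i ` {1..L}"
  unfolding content_packets_def by blast

lemma all_packets_eq_UN: "all_packets s F L = (\<Union>i\<in>{1..F}. content_packets s L i)"
  unfolding all_packets_def content_packets_def by blast

lemma finite_all_packets: "finite (all_packets s F L)"
  by (simp add: all_packets_eq_UN content_packets_eq_image)

lemma content_packets_disjoint: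
  assumes "inj_on (\<lambda>(i, l). s i l) ({1..F} \<times> {1..L})"
    and "i \<in> {1..F}" "j \<in> {1..F}" "i \<noteq> j"
  shows "content_packets s L i \<inter> content_packets s L j = {}"
proof -
  have "s i l \<noteq> s j m" if "l \<in> {1..L}" "m \<in> {1..L}" for l m
    using inj_onD[OF assms(1), of "(i, l)" "(j, m)"] assms that by auto
  then show ?thesis unfolding content_packets_eq_image by blast
qed

text \<open>The blocks cover the ground set and are pairwise disjoint, so they cut \<open>C\<close>
  into disjoint pieces. This is the bridge between the memory constraint and the size bound defining
  independence, and both directions of the equivalence use it.\<close>

lemma card_eq_sum_contents:
  assumes inj: "inj_on (\<lambda>(i, l). s i l) ({1..F} \<times> {1..L})"
    and sub: "C \<subseteq> all_packets s F L"
  shows "card C = (\<Sum>i=1..F. card (C \<inter> content_packets s L i))"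
proof -
  have "C = (\<Union>i\<in>{1..F}. C \<inter> content_packets s L i)"
    using sub by (auto simp: all_packets_eq_UN)
  then have "card C = card (\<Union>i\<in>{1..F}. C \<inter> content_packets s L i)" by simp
  also have "\<dots> = (\<Sum>i=1..F. card (C \<inter> content_packets s L i))"
  proof (rule card_UN_disjoint)
    show "\<forall>i\<in>{1..F}. \<forall>j\<in>{1..F}. i \<noteq> j \<longrightarrow>
        C \<inter> content_packets s L i \<inter> (C \<inter> content_packets s L j) = {}"
      using content_packets_disjoint[OF inj] by blast
  qed (simp_all add: content_packets_eq_image)
  finally show ?thesis .
qed

text \<open>Only the counts matter, so any choice of \<open>k i\<close> packets in each block would
  serve; the witness takes the first \<open>k i\<close> of them. The bound
  \<open>k i \<le> L\<close> keeps these inside the block.\<close>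

lemma ex_packets_with_counts:
  fixes k :: "nat \<Rightarrow> nat"
  assumes inj: "inj_on (\<lambda>(i, l). s i l) ({1..F} \<times> {1..L})"
    and k: "\<And>i. i \<in> {1..F} \<Longrightarrow> k i \<le> L"
  obtains C where "C \<subseteq> all_packets s F L"
    and "\<And>i. i \<in> {1..F} \<Longrightarrow> card (C \<inter> content_packets s L i) = k i"
proof
  let ?C = "\<Union>i\<in>{1..F}. s i ` {1..k i}"
  have sub: "s i ` {1..k i} \<subseteq> content_packets s L i" if "i \<in> {1..F}" for i
    using k[OF that] by (auto simp: content_packets_eq_image)
  then show "?C \<subseteq> all_packets s F L"
    unfolding all_packets_eq_UN by blast
  fix i assume i: "i \<in> {1..F}"
  have "?C \<inter> content_packets s L i = s i ` {1..k i}"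
  proof
    show "?C \<inter> content_packets s L i \<subseteq> s i ` {1..k i}"
    proof
      fix x assume "x \<in> ?C \<inter> content_packets s L i"
      then obtain j where "j \<in> {1..F}" "x \<in> s j ` {1..k j}" "x \<in> content_packets s L i"
        by blast
      \<comment> \<open>Packets chosen for another content \<open>j\<close> lie in block
        \<open>j\<close>, which is disjoint from block \<open>i\<close>, so they do not disturb the
        count for \<open>i\<close>.\<close>
      moreover from this have "j = i"
        using sub[of j] content_packets_disjoint[OF inj _ i, of j] by blast
      ultimately show "x \<in> s i ` {1..k i}" by blast
    qed
    show "s i ` {1..k i} \<subseteq> ?C \<inter> content_packets s L i"
      using sub[OF i] i by blast
  qed
  \<comment> \<open>Distinctness within one content: the \<open>k i\<close> indices give
    \<open>k i\<close> different packets.\<close>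
  moreover have "inj_on (s i) {1..k i}"
  proof (rule inj_onI)
    fix l m assume "l \<in> {1..k i}" "m \<in> {1..k i}" "s i l = s i m"
    then show "l = m"
      using inj_onD[OF inj, of "(i, l)" "(i, m)"] i k[OF i] by auto
  qed
  ultimately show "card (?C \<inter> content_packets s L i) = k i"
    by (simp add: card_image)
qed

theorem proposition1:
  fixes F L M :: nat and s :: "nat \<Rightarrow> nat \<Rightarrow> 'a"
  assumes "F \<ge> 1" and "L \<ge> 1"
    and distinct_packets: "inj_on (\<lambda>(i, l). s i l) ({1..F} \<times> {1..L})"
  shows "matroid (all_packets s F L) (storable_sets s F L M) \<and>
    (\<forall>c :: nat \<Rightarrow> real.
       placement_constraints F L M c \<longleftrightarrow>
       (\<exists>C\<in>storable_sets s F L M.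
          \<forall>i\<in>{1..F}. c i = real (card (C \<inter> content_packets s L i))))"
proof (intro conjI allI iffI)
  show "matroid (all_packets s F L) (storable_sets s F L M)"
    unfolding storable_sets_def by (rule matroid_uniform[OF finite_all_packets])
next
  fix c :: "nat \<Rightarrow> real"
  assume c: "placement_constraints F L M c"
  then have "\<forall>i\<in>{1..F}. \<exists>n. n \<le> L \<and> c i = real n"
    unfolding placement_constraints_def by auto
  \<comment> \<open>Passes from real components to natural counts; \<open>k\<close> is constrained
    only on \<open>{1..F}\<close>.\<close>
  then obtain k where k: "\<And>i. i \<in> {1..F} \<Longrightarrow> k i \<le> L \<and> c i = real (k i)"
    by metis
  obtain C where C: "C \<subseteq> all_packets s F L"
    and card: "\<And>i. i \<in> {1..F} \<Longrightarrow> card (C \<inter> content_packets s L i) = k i"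
    using ex_packets_with_counts[OF distinct_packets, of k] k by blast
  have "real (card C) = (\<Sum>i=1..F. c i)"
    by (simp add: card_eq_sum_contents[OF distinct_packets C] card k)
  then have "card C \<le> M"
    using c unfolding placement_constraints_def by linarith
  then show "\<exists>C\<in>storable_sets s F L M. \<forall>i\<in>{1..F}. c i = real (card (C \<inter> content_packets s L i))"
    using C card k by (intro bexI[of _ C]) (simp_all add: storable_sets_def)
next
  fix c :: "nat \<Rightarrow> real"
  assume "\<exists>C\<in>storable_sets s F L M. \<forall>i\<in>{1..F}. c i = real (card (C \<inter> content_packets s L i))"
  then obtain C where C: "C \<subseteq> all_packets s F L" "card C \<le> M"
    and c: "\<And>i. i \<in> {1..F} \<Longrightarrow> c i = real (card (C \<inter> content_packets s L i))"
    unfolding storable_sets_def by blast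
  \<comment> \<open>This yields the range constraint: a block is the image of \<open>L\<close>
    indices. Integrality comes for free, since each component is a cardinality.\<close>
  have "card (C \<inter> content_packets s L i) \<le> L" for i
  proof -
    have "card (C \<inter> content_packets s L i) \<le> card (content_packets s L i)"
      by (intro card_mono) (auto simp: content_packets_eq_image)
    also have "\<dots> \<le> L"
      using card_image_le[of "{1..L}" "s i"] by (simp add: content_packets_eq_image)
    finally show ?thesis .
  qed
  moreover have "(\<Sum>i=1..F. c i) = real (card C)"
    by (simp add: card_eq_sum_contents[OF distinct_packets C(1)] c)
  ultimately show "placement_constraints F L M c"
    using C(2) c by (auto simp: placement_constraints_def)
qed

end
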